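(* Let $\mathcal H$ be a real Hilbert space, let $A:\mathcal H\to 2^{\mathcal H}$ be a maximally monotone operator such that $S=A^{-1}(0)\neq\emptyset$, and let $t_0>0$. Let $\alpha>2$ and $\lambda(t)=(1+\epsilon)\frac{t^2}{\alpha^2}$ for some $\epsilon>\frac{2}{\alpha-2}$. Let $x:[t_0,+\infty[\to\mathcal H$ be a solution of $$\ddot x(t)+\frac{\alpha}{t}\dot x(t)+A_{\lambda(t)}(x(t))=0,\qquad t>t_0.$$ Then $x(t)$ converges weakly, as $t\to+\infty$, to an element of $S$. Moreover $\lim_{t\to+\infty}\|\dot x(t)\|=\lim_{t\to+\infty}\|\ddot x(t)\|=0$.
   Context: For $\lambda>0$, $J_{\lambda A}=(I+\lambda A)^{-1}$ is the resolvent of $A$ with index $\lambda$ and $A_\lambda=\frac1\lambda(I-J_{\lambda A})$ is its Yosida regularization (an everywhere defined, single-valued, $\frac1\lambda$-Lipschitz operator). $S=A^{-1}(0)=\{z\in\mathcal H: 0\in Az\}$. A solution is a classical ($C^2$) solution on $[t_0,+\infty[$; for every initial condition $x(t_0)=x_0$, $\dot x(t_0)=v_0$ in $\mathcal H$ it exists and is unique. *)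

theory Defs
  imports "HOL-Analysis.Analysis"
begin

text \<open>A set-valued operator on a space of type \<open>'a\<close> is a function \<open>A :: 'a \<Rightarrow> 'a set\<close>;
  its graph is the set of pairs \<open>(x, u)\<close> with \<open>u \<in> A x\<close>.\<close>

definition monotone_operator :: "('a::real_inner \<Rightarrow> 'a set) \<Rightarrow> bool" where
  "monotone_operator A \<longleftrightarrow>
     (\<forall>x y u v. u \<in> A x \<longrightarrow> v \<in> A y \<longrightarrow> 0 \<le> (x - y) \<bullet> (u - v))"

text \<open>Maximality is with respect to inclusion of graphs.\<close>

definition maximally_monotone :: "('a::real_inner \<Rightarrow> 'a set) \<Rightarrow> bool" where
  "maximally_monotone A \<longleftrightarrow> monotone_operator A \<and>
     (\<forall>B. monotone_operator B \<longrightarrow> (\<forall>x. A x \<subseteq> B x) \<longrightarrow> B = A)"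

definition operator_inverse :: "('a \<Rightarrow> 'b set) \<Rightarrow> 'b \<Rightarrow> 'a set" where
  "operator_inverse A y = {x. y \<in> A x}"

text \<open>The resolvent \<open>(I + l A)\<^sup>-\<^sup>1\<close>. The set-valued inverse is a singleton at every point
  when \<open>A\<close> is maximally monotone and \<open>l > 0\<close> (Minty), so \<open>the_elem\<close> selects
  its unique value; otherwise the value may be unspecified.\<close>

definition resolvent :: "real \<Rightarrow> ('a::real_vector \<Rightarrow> 'a set) \<Rightarrow> 'a \<Rightarrow> 'a" where
  "resolvent l A x = the_elem (operator_inverse (\<lambda>z. {z + l *\<^sub>R u | u. u \<in> A z}) x)"

definition yosida :: "real \<Rightarrow> ('a::real_vector \<Rightarrow> 'a set) \<Rightarrow> 'a \<Rightarrow> 'a" where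
  "yosida l A x = (1 / l) *\<^sub>R (x - resolvent l A x)"

text \<open>Convergence in the weak topology, i.e. against every continuous linear functional.\<close>

definition weakly_tendsto ::
    "('b \<Rightarrow> 'a::real_normed_vector) \<Rightarrow> 'a \<Rightarrow> 'b filter \<Rightarrow> bool" where
  "weakly_tendsto f l F \<longleftrightarrow>
     (\<forall>\<phi> :: 'a \<Rightarrow> real. bounded_linear \<phi> \<longrightarrow> ((\<lambda>t. \<phi> (f t)) \<longlongrightarrow> \<phi> l) F)"

text \<open>\<open>x\<close> is of class \<open>C\<^sup>2\<close> on \<open>[t0, \<infinity>[\<close> with first and second derivatives \<open>x'\<close> and \<open>x''\<close>.
  Derivatives are taken within \<open>{t0..}\<close>, hence are right derivatives at \<open>t0\<close>, and
  values of the functions to the left of \<open>t0\<close> are irrelevant.\<close>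

definition C2_from ::
    "real \<Rightarrow> (real \<Rightarrow> 'a::real_normed_vector) \<Rightarrow> (real \<Rightarrow> 'a) \<Rightarrow> (real \<Rightarrow> 'a) \<Rightarrow> bool" where
  "C2_from t0 x x' x'' \<longleftrightarrow>
     (\<forall>t\<ge>t0. (x has_vector_derivative x' t) (at t within {t0..})) \<and>
     (\<forall>t\<ge>t0. (x' has_vector_derivative x'' t) (at t within {t0..})) \<and>
     continuous_on {t0..} x''"

end

theory Submission
  imports Defs
begin

text \<open>
  Write \<open>w t\<close> for the Yosida term and take \<open>z\<close> with \<open>0 \<in> A z\<close>.
  The Yosida regularization of index \<open>\<lambda>\<close> is \<open>\<lambda>\<close>-cocoercive, so
  \<open>\<lambda>(t) \<parallel>w\<parallel>\<^sup>2 \<le> w \<bullet> (x - z)\<close>. By the equation \<open>w = - (x'' + (\<alpha>/t) x')\<close>; since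
  \<open>\<lambda>(t) \<alpha>\<^sup>2 / t\<^sup>2 = 1 + \<epsilon>\<close>, expanding the square produces \<open>(1 + \<epsilon>) \<parallel>x'\<parallel>\<^sup>2\<close>, which
  exceeds the kinetic term \<open>\<parallel>x'\<parallel>\<^sup>2\<close> in the second derivative of \<open>\<parallel>x - z\<parallel>\<^sup>2 / 2\<close> by
  \<open>\<epsilon> \<parallel>x'\<parallel>\<^sup>2\<close>. It also produces a cross term which, after multiplication by \<open>t\<close> and with
  \<open>c = (1 + \<epsilon>) / \<alpha>\<close>, is the derivative of \<open>c t\<^sup>2 \<parallel>x'\<parallel>\<^sup>2\<close> up to a loss of
  \<open>2 c t \<parallel>x'\<parallel>\<^sup>2\<close>. Hence the energy
  \<open>W = t (x' \<bullet> (x - z)) + (\<alpha> - 1) / 2 \<parallel>x - z\<parallel>\<^sup>2 + c t\<^sup>2 \<parallel>x'\<parallel>\<^sup>2\<close> satisfies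
  \<open>W' \<le> - \<kappa> (t \<parallel>x'\<parallel>\<^sup>2 + t\<^sup>3 \<parallel>x''\<parallel>\<^sup>2)\<close> with \<open>\<kappa> > 0\<close>. The condition
  \<open>\<epsilon> > 2 / (\<alpha> - 2)\<close> is exactly \<open>\<epsilon> > 2 c\<close>, which makes \<open>\<kappa>\<close> positive, and it also makes \<open>W\<close> a
  positive definite quadratic form in \<open>t x'\<close> and \<open>x - z\<close>. So \<open>W\<close> converges; from this
  \<open>t \<parallel>x'\<parallel> \<longlongrightarrow> 0\<close>, and \<open>\<parallel>x - z\<parallel>\<close> converges for every zero \<open>z\<close> (lemma
  \<open>inertial_energy_estimates\<close>).

  The mean value theorem for \<open>W\<close> on \<open>[t, 2 t]\<close> gives a time \<open>s\<close> between
  \<open>t\<close> and \<open>2 t\<close> at which \<open>s \<parallel>x' s\<parallel>\<close> and \<open>s\<^sup>2 \<parallel>x'' s\<parallel>\<close> are small, so that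
  \<open>\<lambda>(s) w s\<close> is small. Because \<open>t \<parallel>x'\<parallel> \<longlongrightarrow> 0\<close>, the trajectory hardly moves between \<open>t\<close> and
  \<open>s\<close>. Thus \<open>x t\<close> is close to the point \<open>y = x s - \<lambda>(s) w s\<close>, at which \<open>w s \<in> A y\<close> is
  small, and monotonicity yields \<open>limsup (x t - a) \<bullet> b \<le> 0\<close> for every \<open>b \<in> A a\<close>.
  The zeros of \<open>A\<close> are precisely the points \<open>z\<close> with \<open>(z - a) \<bullet> b \<le> 0\<close> for all such pairs, so
  this says that \<open>x\<close> asymptotically enters every halfspace that cuts out the zero set, and Opial's
  argument (\<open>opial_halfspaces\<close>) gives the weak limit.

  That \<open>w\<close> is a value of \<open>A\<close> at all is Minty's theorem, and
  Opial's argument usually rests on weak compactness. Both are derived here from one elementary principle,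
  \<open>minimizing_sequence_converges\<close>: a minimizing sequence of a uniformly midpoint convex function
  is Cauchy. For Minty's theorem it is applied to a dual problem over a convex hull of the graph; for weak
  convergence it provides asymptotic centres, which stand in for weak cluster points.
\<close>

section \<open>Minimizing sequences in a Hilbert space\<close>

text \<open>Two nearly optimal points have a midpoint whose value cannot drop below the infimum, so the gain
  \<open>\<parallel>g p - g q\<parallel>\<^sup>2 / 4\<close> must be small. The map \<open>g\<close> allows convexity to be
  uniform in only some of the coordinates, as in the dual problem behind Minty's theorem.\<close>

lemma minimizing_sequence_converges:
  fixes f :: "'k \<Rightarrow> real" and g :: "'k \<Rightarrow> 'a::{real_inner,complete_space}"
  assumes ne: "K \<noteq> {}" and bdd: "bdd_below (f ` K)"
    and mid: "\<And>p q. p \<in> K \<Longrightarrow> q \<in> K \<Longrightarrow> \<exists>m\<in>K. f m \<le> (f p + f q) / 2 - (norm (g p - g q))\<^sup>2 / 4"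
  obtains P z where "\<And>n::nat. P n \<in> K" "(\<lambda>n. f (P n)) \<longlonglongrightarrow> (INF k\<in>K. f k)" "(\<lambda>n. g (P n)) \<longlonglongrightarrow> z"
proof -
  define I where "I = (INF k\<in>K. f k)"
  have lower: "I \<le> f k" if "k \<in> K" for k
    unfolding I_def using bdd that by (rule cINF_lower)
  have "\<exists>k\<in>K. f k < I + 1 / real (Suc n)" for n
  proof -
    have "(INF k\<in>K. f k) < I + 1 / real (Suc n)" by (simp add: I_def)
    thus ?thesis using cINF_less_iff[OF ne bdd] by blast
  qed
  then obtain P where P: "\<And>n. P n \<in> K" "\<And>n. f (P n) < I + 1 / real (Suc n)" by metis
  have lim0: "(\<lambda>n. I + 1 / real (Suc n)) \<longlonglongrightarrow> I + 0"
    by (intro tendsto_intros) (use LIMSEQ_inverse_real_of_nat in \<open>simp add: inverse_eq_divide\<close>)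
  have lim: "(\<lambda>n. f (P n)) \<longlonglongrightarrow> I"
    by (rule tendsto_sandwich[OF _ _ tendsto_const])
      (use P lower lim0 in \<open>auto intro!: always_eventually simp: less_imp_le\<close>)
  have "Cauchy (\<lambda>n. g (P n))"
  proof (rule CauchyI)
    fix e :: real assume e: "e > 0"
    have "eventually (\<lambda>n. f (P n) < I + e\<^sup>2 / 4) sequentially"
      using order_tendstoD(2)[OF lim, of "I + e\<^sup>2 / 4"] e by simp
    then obtain N where N: "\<And>n. n \<ge> N \<Longrightarrow> f (P n) < I + e\<^sup>2 / 4"
      by (auto simp: eventually_sequentially)
    have "norm (g (P m) - g (P n)) < e" if "m \<ge> N" "n \<ge> N" for m n
    proof -
      obtain k where k: "k \<in> K" "f k \<le> (f (P m) + f (P n)) / 2 - (norm (g (P m) - g (P n)))\<^sup>2 / 4"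
        using mid P(1) by blast
      have "(norm (g (P m) - g (P n)))\<^sup>2 < e\<^sup>2"
        using lower[OF k(1)] k(2) N[OF that(1)] N[OF that(2)] by argo
      thus ?thesis using e by (simp add: power_less_imp_less_base)
    qed
    thus "\<exists>N. \<forall>m\<ge>N. \<forall>n\<ge>N. norm (g (P m) - g (P n)) < e" by blast
  qed
  then obtain z where "(\<lambda>n. g (P n)) \<longlonglongrightarrow> z"
    using Cauchy_convergent_iff convergent_def by blast
  with P(1) lim that show ?thesis unfolding I_def by blast
qed

lemma norm_midpoint_sq:
  fixes a b w :: "'a::real_inner"
  shows "(norm (w - (1/2) *\<^sub>R (a + b)))\<^sup>2 = ((norm (w - a))\<^sup>2 + (norm (w - b))\<^sup>2) / 2 - (norm (a - b))\<^sup>2 / 4"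
  unfolding power2_norm_eq_inner
  by (simp add: inner_diff_left inner_diff_right inner_add_left inner_add_right inner_commute field_simps)

text \<open>The representing vector minimizes \<open>\<parallel>y\<parallel>\<^sup>2 - 2 \<phi> y\<close>.\<close>

lemma riesz_representation:
  fixes \<phi> :: "'a::{real_inner,complete_space} \<Rightarrow> real"
  assumes "bounded_linear \<phi>"
  obtains v where "\<And>y. \<phi> y = v \<bullet> y"
proof -
  interpret \<phi>: bounded_linear \<phi> by fact
  define f where "f y = (norm y)\<^sup>2 - 2 * \<phi> y" for y
  obtain C where C: "\<And>y. norm (\<phi> y) \<le> norm y * C" using \<phi>.bounded by blast
  have "- C\<^sup>2 \<le> f y" for y
  proof -
    have "0 \<le> (norm y - C)\<^sup>2" by simp
    moreover have "\<phi> y \<le> norm y * C" using C[of y] by simp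
    ultimately show ?thesis unfolding f_def power2_diff by linarith
  qed
  hence bdd: "bdd_below (f ` UNIV)" by (auto intro!: bdd_belowI)
  have mid: "f ((1/2) *\<^sub>R (p + q)) = (f p + f q) / 2 - (norm (p - q))\<^sup>2 / 4" for p q
    unfolding f_def power2_norm_eq_inner
    by (simp add: \<phi>.scaleR \<phi>.add inner_diff_left inner_diff_right inner_add_left inner_add_right inner_commute field_simps)
  obtain P v where P: "(\<lambda>n::nat. f (P n)) \<longlonglongrightarrow> (INF k. f k)" "P \<longlonglongrightarrow> v"
    by (rule minimizing_sequence_converges[OF UNIV_not_empty bdd, of "\<lambda>y. y"]) (use mid eq_refl in \<open>blast+\<close>)
  have "(\<lambda>n. f (P n)) \<longlonglongrightarrow> f v"
    unfolding f_def by (intro tendsto_intros P(2) \<phi>.tendsto)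
  hence fv: "f v = (INF k. f k)" using P(1) LIMSEQ_unique by blast
  have min: "f v \<le> f y" for y unfolding fv by (rule cINF_lower[OF bdd]) simp
  have "\<phi> y = v \<bullet> y" for y
  proof (rule ccontr)
    assume ne: "\<phi> y \<noteq> v \<bullet> y"
    define d where "d = \<phi> y - v \<bullet> y"
    have d: "d \<noteq> 0" using ne by (simp add: d_def)
    have y: "y \<noteq> 0" using ne \<phi>.zero by auto
    \<comment> \<open>The step that minimizes \<open>f\<close> along the line through \<open>v\<close> in direction \<open>y\<close>.\<close>
    define s where "s = d / (y \<bullet> y)"
    have "f (v + s *\<^sub>R y) = f v - 2 * s * d + s\<^sup>2 * (y \<bullet> y)"
      unfolding f_def power2_norm_eq_inner d_def
      by (simp add: \<phi>.add \<phi>.scaleR inner_add_left inner_add_right inner_commute power2_eq_square algebra_simps)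
    also have "\<dots> = f v - d\<^sup>2 / (y \<bullet> y)"
      using y by (simp add: s_def power2_eq_square field_simps)
    also have "\<dots> < f v" using d y by simp
    finally show False using min[of "v + s *\<^sub>R y"] by simp
  qed
  thus ?thesis using that by blast
qed

section \<open>Minty's theorem and the Yosida regularization\<close>

text \<open>The condition on \<open>z\<close> reads
  \<open>\<parallel>z\<parallel>\<^sup>2 + z \<bullet> (b - a) - a \<bullet> b \<le> 0\<close>, so one has to make the supremum over \<open>G\<close> of these
  functions of \<open>z\<close> nonpositive. Averaging with weights of barycentre \<open>(p, q)\<close>, and \<open>r\<close> the average of
  \<open>a \<bullet> b\<close>, the minimum over \<open>z\<close> is \<open>- \<parallel>p - q\<parallel>\<^sup>2 / 4 - r\<close>, attained at \<open>(p - q) / 2\<close>.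
  The dual problem is therefore to minimize \<open>f (p, q, r) = \<parallel>p - q\<parallel>\<^sup>2 / 4 + r\<close> over the convex
  hull \<open>K\<close> of the triples \<open>(a, b, a \<bullet> b)\<close>. Monotonicity enters only through \<open>p \<bullet> q \<le> r\<close> on
  \<open>K\<close>, which gives \<open>f \<ge> \<parallel>p + q\<parallel>\<^sup>2 / 4 \<ge> 0\<close>. The infimum of \<open>f\<close> need not be
  attained, but along a minimizing sequence \<open>(p - q) / 2\<close> converges, and perturbing that sequence
  towards a generator \<open>(a, b, a \<bullet> b)\<close> shows that the limit satisfies the condition for \<open>(a, b)\<close>.\<close>

lemma minty_monotone_extension:
  fixes G :: "('a::{real_inner,complete_space} \<times> 'a) set"
  assumes mono: "\<And>a b c d. (a, b) \<in> G \<Longrightarrow> (c, d) \<in> G \<Longrightarrow> 0 \<le> (a - c) \<bullet> (b - d)"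
  obtains z where "\<And>a b. (a, b) \<in> G \<Longrightarrow> (z - a) \<bullet> (z + b) \<le> 0"
proof (cases "G = {}")
  case True thus ?thesis using that by blast
next
  case False
  define lift where "lift = (\<lambda>(a::'a, b). (a, b, a \<bullet> b))"
  define K where "K = convex hull (lift ` G)"
  define f where "f = (\<lambda>(p::'a, q, r). (norm (p - q))\<^sup>2 / 4 + r)"
  define g where "g = (\<lambda>(p::'a, q::'a, r::real). (1/2) *\<^sub>R (p - q))"
  have gen: "lift k \<in> K" if "k \<in> G" for k
    unfolding K_def using that by (intro hull_inc) auto
  have conv: "convex K" by (simp add: K_def convex_convex_hull)
  \<comment> \<open>The inequality is affine in each of two points of \<open>K\<close> and holds for pairs of generators, so it
    extends to \<open>K\<close> in one argument (\<open>half\<close>) and then in the other, and \<open>dual\<close> is its diagonal.\<close>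
  have half: "0 \<le> r - p \<bullet> b - a \<bullet> q + a \<bullet> b" if ab: "(a, b) \<in> G" and k: "(p, q, r) \<in> K" for a b p q r
  proof -
    have "K \<subseteq> {(p, q, r). 0 \<le> r - p \<bullet> b - a \<bullet> q + a \<bullet> b}"
      unfolding K_def
    proof (rule hull_minimal)
      show "lift ` G \<subseteq> {(p, q, r). 0 \<le> r - p \<bullet> b - a \<bullet> q + a \<bullet> b}"
      proof clarsimp
        fix c d e e' f assume "(e, e') \<in> G" "(c, d, f) = lift (e, e')"
        thus "0 \<le> f - c \<bullet> b - a \<bullet> d + a \<bullet> b"
          using mono[OF _ ab, of e e'] by (simp add: lift_def inner_diff_left inner_diff_right)
      qed
      have "{(p, q, r). 0 \<le> r - p \<bullet> b - a \<bullet> q + a \<bullet> b} = {k. (b, a, -1) \<bullet> k \<le> a \<bullet> b}"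
        by (auto simp: inner_commute)
      thus "convex {(p, q, r). 0 \<le> r - p \<bullet> b - a \<bullet> q + a \<bullet> b}" by (simp add: convex_halfspace_le)
    qed
    thus ?thesis using k by auto
  qed
  have dual: "p \<bullet> q \<le> r" if k: "(p, q, r) \<in> K" for p q r
  proof -
    have "K \<subseteq> {(p', q', r'). 0 \<le> r' - p \<bullet> q' - p' \<bullet> q + r}"
      unfolding K_def
    proof (rule hull_minimal)
      show "lift ` G \<subseteq> {(p', q', r'). 0 \<le> r' - p \<bullet> q' - p' \<bullet> q + r}"
        using half[OF _ k] by (fastforce simp: lift_def)
      have "{(p', q', r'). 0 \<le> r' - p \<bullet> q' - p' \<bullet> q + r} = {k. (q, p, -1) \<bullet> k \<le> r}"
        by (auto simp: inner_commute)
      thus "convex {(p', q', r'). 0 \<le> r' - p \<bullet> q' - p' \<bullet> q + r}" by (simp add: convex_halfspace_le)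
    qed
    thus ?thesis using k by auto
  qed
  have nonneg: "0 \<le> f k" if "k \<in> K" for k
  proof -
    obtain p q r where k: "k = (p, q, r)" by (cases k)
    have "0 \<le> (norm (p + q))\<^sup>2 / 4" by simp
    also have "\<dots> = (norm (p - q))\<^sup>2 / 4 + p \<bullet> q"
      unfolding power2_norm_eq_inner
      by (simp add: inner_diff_left inner_diff_right inner_add_left inner_add_right inner_commute field_simps)
    also have "\<dots> \<le> f k" using dual that by (simp add: k f_def)
    finally show ?thesis .
  qed
  have comb: "f ((1 - s) *\<^sub>R k + s *\<^sub>R l) = (1 - s) * f k + s * f l - s * (1 - s) * (norm (g k - g l))\<^sup>2" for s k l
  proof -
    obtain p q r where k: "k = (p, q, r)" by (cases k)
    obtain p' q' r' where l: "l = (p', q', r')" by (cases l)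
    define u v where "u = p - q" and "v = p' - q'"
    have "(1 - s) *\<^sub>R p + s *\<^sub>R p' - ((1 - s) *\<^sub>R q + s *\<^sub>R q') = (1 - s) *\<^sub>R u + s *\<^sub>R v"
      by (simp add: u_def v_def algebra_simps)
    hence comb_uv: "f ((1 - s) *\<^sub>R k + s *\<^sub>R l) = (norm ((1 - s) *\<^sub>R u + s *\<^sub>R v))\<^sup>2 / 4 + ((1 - s) * r + s * r')"
      by (simp add: k l f_def)
    have "g k - g l = (1/2) *\<^sub>R (u - v)"
      by (simp add: k l g_def u_def v_def scaleR_diff_right)
    hence g_uv: "(norm (g k - g l))\<^sup>2 = (norm (u - v))\<^sup>2 / 4"
      by (simp add: power_divide)
    have f_uv: "f k = (norm u)\<^sup>2 / 4 + r" "f l = (norm v)\<^sup>2 / 4 + r'"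
      by (simp_all add: k l f_def u_def v_def)
    have gen: "(norm ((1 - s) *\<^sub>R u + s *\<^sub>R v))\<^sup>2 = (1 - s) * (norm u)\<^sup>2 + s * (norm v)\<^sup>2 - s * (1 - s) * (norm (u - v))\<^sup>2" for u v :: 'a
      unfolding power2_norm_eq_inner
      by (simp add: inner_diff_left inner_diff_right inner_add_left inner_add_right inner_commute algebra_simps)
    show ?thesis
      unfolding comb_uv g_uv f_uv gen by (simp add: field_simps)
  qed
  have ne: "K \<noteq> {}" using False gen by blast
  have bdd: "bdd_below (f ` K)" using nonneg by (auto intro!: bdd_belowI)
  have closed_comb: "(1 - s) *\<^sub>R k + s *\<^sub>R l \<in> K" if "k \<in> K" "l \<in> K" "0 \<le> s" "s \<le> 1" for k l s
    using conv that by (intro convexD) auto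
  define I where "I = (INF k\<in>K. f k)"
  have I_le: "I \<le> f k" if "k \<in> K" for k
    unfolding I_def using bdd that by (rule cINF_lower)
  have I0: "0 \<le> I" unfolding I_def using ne nonneg by (intro cINF_greatest)
  obtain P z where P: "\<And>n::nat. P n \<in> K" "(\<lambda>n. f (P n)) \<longlonglongrightarrow> I" "(\<lambda>n. g (P n)) \<longlonglongrightarrow> z"
    unfolding I_def
  proof (rule minimizing_sequence_converges[OF ne bdd, of g])
    fix k l assume "k \<in> K" "l \<in> K"
    thus "\<exists>m\<in>K. f m \<le> (f k + f l) / 2 - (norm (g k - g l))\<^sup>2 / 4"
      using closed_comb[of k l "1/2"] comb[of "1/2" k l] by (intro bexI[of _ "(1 - 1/2) *\<^sub>R k + (1/2) *\<^sub>R l"]) auto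
  qed blast
  \<comment> \<open>First-order optimality in direction \<open>k\<close>: compare the infimum with the value a small step \<open>s\<close>
    along the minimizing sequence towards \<open>k\<close>, and let \<open>s\<close> tend to 0.\<close>
  have key: "(norm (z - g k))\<^sup>2 \<le> f k - I" if k: "k \<in> K" for k
  proof (rule field_le_mult_one_interval)
    fix \<theta> :: real assume \<theta>: "0 < \<theta>" "\<theta> < 1"
    define s where "s = 1 - \<theta>"
    have s: "0 < s" "s < 1" using \<theta> by (auto simp: s_def)
    have "(\<lambda>n. (1 - s) * f (P n) + s * f k - s * (1 - s) * (norm (g (P n) - g k))\<^sup>2)
        \<longlonglongrightarrow> (1 - s) * I + s * f k - s * (1 - s) * (norm (z - g k))\<^sup>2"
      by (intro tendsto_intros P)
    moreover have "I \<le> (1 - s) * f (P n) + s * f k - s * (1 - s) * (norm (g (P n) - g k))\<^sup>2" for n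
      using I_le[OF closed_comb[OF P(1) k, of s n]] s by (simp add: comb)
    ultimately have "I \<le> (1 - s) * I + s * f k - s * (1 - s) * (norm (z - g k))\<^sup>2"
      by (intro LIMSEQ_le_const) auto
    hence "s * ((1 - s) * (norm (z - g k))\<^sup>2) \<le> s * (f k - I)" by (simp add: algebra_simps)
    thus "\<theta> * (norm (z - g k))\<^sup>2 \<le> f k - I" using s by (simp add: s_def)
  qed
  have "(z - a) \<bullet> (z + b) \<le> 0" if "(a, b) \<in> G" for a b
  proof -
    have "(norm (z - g (lift (a, b))))\<^sup>2 \<le> f (lift (a, b))"
      using key[OF gen[OF that]] I0 by linarith
    thus ?thesis
      unfolding lift_def f_def g_def power2_norm_eq_inner
      by (simp add: inner_diff_left inner_diff_right inner_add_left inner_add_right inner_commute field_simps)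
  qed
  thus ?thesis using that by blast
qed

lemma maximally_monotoneD:
  assumes "maximally_monotone A" and "\<And>y v. v \<in> A y \<Longrightarrow> 0 \<le> (z - y) \<bullet> (u - v)"
  shows "u \<in> A z"
proof -
  define B where "B = A(z := insert u (A z))"
  have A: "monotone_operator A" using assms(1) by (simp add: maximally_monotone_def)
  have "0 \<le> (y - z) \<bullet> (v - u)" if "v \<in> A y" for y v
    using assms(2)[OF that] by (simp add: inner_diff_left inner_diff_right)
  hence "monotone_operator B"
    using A assms(2) unfolding monotone_operator_def B_def by auto
  moreover have "\<forall>y. A y \<subseteq> B y" by (auto simp: B_def)
  ultimately have "B = A" using assms(1) by (simp add: maximally_monotone_def)
  thus ?thesis by (metis B_def fun_upd_same insertI1)
qed

lemma maximally_monotone_inner_nonneg: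
  assumes "maximally_monotone A" "u \<in> A y" "v \<in> A z"
  shows "0 \<le> (y - z) \<bullet> (u - v)"
  using assms unfolding maximally_monotone_def monotone_operator_def by blast

lemma zeros_eq_halfspaces:
  assumes "maximally_monotone A"
  shows "operator_inverse A 0 = {z. \<forall>a b. b \<in> A a \<longrightarrow> (z - a) \<bullet> b \<le> 0}"
proof -
  have "(z - a) \<bullet> b \<le> 0" if "0 \<in> A z" "b \<in> A a" for z a b
  proof -
    have "0 \<le> (z - a) \<bullet> (0 - b)"
      using maximally_monotone_inner_nonneg[OF assms that] .
    thus ?thesis by simp
  qed
  moreover have "0 \<in> A z" if "\<forall>a b. b \<in> A a \<longrightarrow> (z - a) \<bullet> b \<le> 0" for z
    using maximally_monotoneD[OF assms, of z 0] that by simp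
  ultimately show ?thesis unfolding operator_inverse_def by blast
qed

text \<open>For given \<open>y\<close> the resolvent \<open>w\<close> is characterized by
  \<open>(w - a) \<bullet> ((y - w) / l - b) \<ge> 0\<close> for all \<open>b \<in> A a\<close>; multiplied by \<open>- l\<close>, this is the conclusion
  of \<open>minty_monotone_extension\<close> for the scaled and shifted graph of pairs \<open>(a, l b - y)\<close>. Uniqueness
  of \<open>w\<close>, hence the meaning of \<open>the_elem\<close>, is monotonicity again.\<close>

lemma yosida_in_operator:
  fixes A :: "'a::{real_inner,complete_space} \<Rightarrow> 'a set"
  assumes A: "maximally_monotone A" and l: "l > 0"
  shows "yosida l A y \<in> A (y - l *\<^sub>R yosida l A y)"
proof -
  note mono = maximally_monotone_inner_nonneg[OF A]
  obtain w where w: "\<And>a b. (a, b) \<in> {(a, l *\<^sub>R b - y) | a b. b \<in> A a} \<Longrightarrow> (w - a) \<bullet> (w + b) \<le> 0"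
  proof (rule minty_monotone_extension[of "{(a, l *\<^sub>R b - y) | a b. b \<in> A a}"])
    fix a b c d assume "(a, b) \<in> {(a, l *\<^sub>R b - y) | a b. b \<in> A a}" "(c, d) \<in> {(a, l *\<^sub>R b - y) | a b. b \<in> A a}"
    then obtain b' d' where "b' \<in> A a" "d' \<in> A c" and bd: "b = l *\<^sub>R b' - y" "d = l *\<^sub>R d' - y" by blast
    hence "0 \<le> l * ((a - c) \<bullet> (b' - d'))" using mono l by simp
    also have "\<dots> = (a - c) \<bullet> (b - d)" by (simp add: bd inner_diff_right algebra_simps)
    finally show "0 \<le> (a - c) \<bullet> (b - d)" .
  qed blast
  define u where "u = (1 / l) *\<^sub>R (y - w)"
  have y: "y = w + l *\<^sub>R u" using l by (simp add: u_def)
  have u: "u \<in> A w"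
  proof (rule maximally_monotoneD[OF A])
    fix a b assume "b \<in> A a"
    hence "(w - a) \<bullet> (w + (l *\<^sub>R b - y)) \<le> 0" using w by blast
    hence "0 \<le> l * ((w - a) \<bullet> (u - b))"
      unfolding y by (simp add: inner_diff_right inner_add_right algebra_simps)
    thus "0 \<le> (w - a) \<bullet> (u - b)" using l by (simp add: zero_le_mult_iff)
  qed
  have "w' = w" if "y = w' + l *\<^sub>R u'" "u' \<in> A w'" for w' u'
  proof -
    have eq: "w' - w = - (l *\<^sub>R (u' - u))" using that(1) y by (simp add: algebra_simps)
    have "0 \<le> (w' - w) \<bullet> (u' - u)" using mono[OF that(2) u] .
    hence "l * ((u' - u) \<bullet> (u' - u)) \<le> 0" by (simp add: eq)
    hence "(u' - u) \<bullet> (u' - u) \<le> 0" using l by (simp add: mult_le_0_iff)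
    hence "u' = u" by (metis eq_iff_diff_eq_0 inner_ge_zero inner_eq_zero_iff order_antisym)
    thus ?thesis using eq by simp
  qed
  hence "operator_inverse (\<lambda>z. {z + l *\<^sub>R u | u. u \<in> A z}) y = {w}"
    unfolding operator_inverse_def using y u by blast
  hence "resolvent l A y = w" by (simp add: resolvent_def)
  hence "yosida l A y = u" by (simp add: yosida_def u_def)
  moreover have "y - l *\<^sub>R u = w" by (simp add: y)
  ultimately show ?thesis using u by simp
qed

lemma yosida_cocoercive_at_zero:
  fixes A :: "'a::{real_inner,complete_space} \<Rightarrow> 'a set"
  assumes "maximally_monotone A" "l > 0" "0 \<in> A z"
  shows "l * (norm (yosida l A y))\<^sup>2 \<le> yosida l A y \<bullet> (y - z)"
proof -
  have "0 \<le> (y - l *\<^sub>R yosida l A y - z) \<bullet> (yosida l A y - 0)"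
    using maximally_monotone_inner_nonneg[OF assms(1) yosida_in_operator[OF assms(1,2)] assms(3)] .
  thus ?thesis by (simp add: power2_norm_eq_inner inner_diff_left inner_diff_right inner_commute)
qed

section \<open>Weak convergence through asymptotic centres\<close>

lemma eventually_bounded_of_distance_tendsto:
  fixes x :: "'b \<Rightarrow> 'a::real_normed_vector"
  assumes "((\<lambda>t. (norm (x t - z))\<^sup>2) \<longlongrightarrow> l) F"
  obtains M where "eventually (\<lambda>t. norm (x t) \<le> M) F"
proof -
  have "eventually (\<lambda>t. (norm (x t - z))\<^sup>2 < l + 1) F" using assms by (intro order_tendstoD) auto
  hence "eventually (\<lambda>t. norm (x t) \<le> sqrt (l + 1) + norm z) F"
  proof eventually_elim
    case (elim t)
    hence "norm (x t - z) \<le> sqrt (l + 1)" by (intro real_le_rsqrt) simp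
    thus ?case using norm_triangle_sub[of "x t" z] by linarith
  qed
  thus ?thesis using that by blast
qed

text \<open>An asymptotic centre \<open>z\<close> of \<open>x\<close> along \<open>F\<close> minimizes \<open>f y = limsup \<parallel>x t - y\<parallel>\<^sup>2\<close>.
  The conclusion expresses this without the limsup: no \<open>y\<close> is eventually closer to \<open>x t\<close> than \<open>z\<close> by
  a fixed margin of squared distance. It replaces a weak cluster point.\<close>

lemma asymptotic_centre_exists:
  fixes x :: "'b \<Rightarrow> 'a::{real_inner,complete_space}"
  assumes F: "F \<noteq> bot" and M: "eventually (\<lambda>t. norm (x t) \<le> M) F"
  obtains z where "\<And>y d. d > 0 \<Longrightarrow> \<not> eventually (\<lambda>t. (norm (x t - y))\<^sup>2 \<le> (norm (x t - z))\<^sup>2 - d) F"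
proof -
  define B where "B y = {c. eventually (\<lambda>t. (norm (x t - y))\<^sup>2 \<le> c) F}" for y
  define f where "f y = Inf (B y)" for y
  have B0: "0 \<le> c" if "c \<in> B y" for c y
  proof -
    have "eventually (\<lambda>t. 0 \<le> c) F"
      using that unfolding B_def by (auto elim!: eventually_mono intro: order_trans[OF zero_le_power2])
    thus ?thesis using F by simp
  qed
  have bddB: "bdd_below (B y)" for y using B0 by (auto intro!: bdd_belowI)
  have neB: "B y \<noteq> {}" for y
  proof -
    have "eventually (\<lambda>t. (norm (x t - y))\<^sup>2 \<le> (M + norm y)\<^sup>2) F"
      using M
    proof eventually_elim
      case (elim t)
      hence "norm (x t - y) \<le> M + norm y" using norm_triangle_ineq4[of "x t" y] by linarith
      thus ?case by (intro power_mono) auto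
    qed
    thus ?thesis unfolding B_def by blast
  qed
  have f_le: "f y \<le> c" if "eventually (\<lambda>t. (norm (x t - y))\<^sup>2 \<le> c) F" for y c
    unfolding f_def using that bddB by (intro cInf_lower) (auto simp: B_def)
  have f_ev: "eventually (\<lambda>t. (norm (x t - y))\<^sup>2 \<le> c) F" if less: "f y < c" for y c
  proof -
    obtain c' where "c' \<in> B y" "c' < c" using cInf_lessD[OF neB less[unfolded f_def]] by blast
    thus ?thesis unfolding B_def by (auto elim!: eventually_mono)
  qed
  have f0: "0 \<le> f y" for y unfolding f_def using neB B0 by (intro cInf_greatest)
  have bdd: "bdd_below (f ` UNIV)" using f0 by (auto intro!: bdd_belowI)
  have mid: "f ((1/2) *\<^sub>R (p + q)) \<le> (f p + f q) / 2 - (norm (p - q))\<^sup>2 / 4" for p q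
  proof (rule field_le_epsilon)
    fix e :: real assume e: "0 < e"
    have "eventually (\<lambda>t. (norm (x t - p))\<^sup>2 \<le> f p + e) F" "eventually (\<lambda>t. (norm (x t - q))\<^sup>2 \<le> f q + e) F"
      using e by (auto intro: f_ev)
    hence "eventually (\<lambda>t. (norm (x t - (1/2) *\<^sub>R (p + q)))\<^sup>2 \<le> (f p + f q) / 2 - (norm (p - q))\<^sup>2 / 4 + e) F"
      unfolding norm_midpoint_sq by eventually_elim argo
    thus "f ((1/2) *\<^sub>R (p + q)) \<le> (f p + f q) / 2 - (norm (p - q))\<^sup>2 / 4 + e" by (rule f_le)
  qed
  define I where "I = (INF y. f y)"
  have I_le: "I \<le> f y" for y unfolding I_def by (rule cINF_lower[OF bdd]) simp
  obtain P z where P: "(\<lambda>n::nat. f (P n)) \<longlonglongrightarrow> I" "P \<longlonglongrightarrow> z"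
    unfolding I_def
    by (rule minimizing_sequence_converges[OF UNIV_not_empty bdd, of "\<lambda>y. y"]) (use mid in \<open>blast+\<close>)
  \<comment> \<open>The limit \<open>z\<close> of the minimizing sequence attains the infimum, since \<open>f\<close> is continuous.\<close>
  have near: "eventually (\<lambda>t. (norm (x t - z))\<^sup>2 \<le> I + e) F" if e: "e > 0" for e
  proof -
    have "(\<lambda>n. f (P n) + norm (P n - z) * (2 * M + norm (P n) + norm z)) \<longlonglongrightarrow> I + norm (z - z) * (2 * M + norm z + norm z)"
      by (intro tendsto_intros P)
    hence "eventually (\<lambda>n. f (P n) + norm (P n - z) * (2 * M + norm (P n) + norm z) < I + e) sequentially"
      using e by (intro order_tendstoD) auto
    then obtain n where n: "f (P n) + norm (P n - z) * (2 * M + norm (P n) + norm z) < I + e"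
      by (auto simp: eventually_sequentially)
    define c where "c = I + e - norm (P n - z) * (2 * M + norm (P n) + norm z)"
    have "eventually (\<lambda>t. (norm (x t - P n))\<^sup>2 \<le> c) F" using n by (intro f_ev) (simp add: c_def)
    thus ?thesis using M
    proof eventually_elim
      case (elim t)
      have 1: "norm (x t - z) - norm (x t - P n) \<le> norm (P n - z)"
        using norm_triangle_ineq[of "x t - P n" "P n - z"] by simp
      have 2: "norm (x t - z) + norm (x t - P n) \<le> 2 * M + norm (P n) + norm z"
        using norm_triangle_ineq4[of "x t" z] norm_triangle_ineq4[of "x t" "P n"] elim(2) by linarith
      have "(norm (x t - z))\<^sup>2 - (norm (x t - P n))\<^sup>2
          = (norm (x t - z) - norm (x t - P n)) * (norm (x t - z) + norm (x t - P n))"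
        by (simp add: power2_eq_square algebra_simps)
      also have "\<dots> \<le> norm (P n - z) * (norm (x t - z) + norm (x t - P n))"
        using 1 by (intro mult_right_mono) auto
      also have "\<dots> \<le> norm (P n - z) * (2 * M + norm (P n) + norm z)"
        using 2 by (intro mult_left_mono) auto
      finally show ?case using elim(1) unfolding c_def by linarith
    qed
  qed
  have "\<not> eventually (\<lambda>t. (norm (x t - y))\<^sup>2 \<le> (norm (x t - z))\<^sup>2 - d) F" if d: "d > 0" for y d
  proof
    assume "eventually (\<lambda>t. (norm (x t - y))\<^sup>2 \<le> (norm (x t - z))\<^sup>2 - d) F"
    moreover have "eventually (\<lambda>t. (norm (x t - z))\<^sup>2 \<le> I + d / 2) F" using d by (intro near) simp
    ultimately have "eventually (\<lambda>t. (norm (x t - y))\<^sup>2 \<le> I - d / 2) F"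
      by eventually_elim argo
    hence "f y \<le> I - d / 2" by (rule f_le)
    thus False using I_le[of y] d by linarith
  qed
  thus ?thesis using that by blast
qed

text \<open>This is Opial's lemma for a set cut out by halfspaces. Let \<open>H\<close> be a filter finer than
  \<open>F\<close>. A centre along \<open>H\<close> lies in every halfspace, because projecting it onto a halfspace that \<open>x\<close>
  asymptotically enters would bring it closer to \<open>x\<close>; so it lies in \<open>S\<close>. On \<open>S\<close> the
  distances to \<open>x\<close> converge along \<open>F\<close>, hence to the same limits along every \<open>H\<close>, and all
  centres agree with one point \<open>z\<close>. If \<open>(x t - z) \<bullet> v \<ge> e > 0\<close> held frequently, then along the filter
  \<open>H\<close> of those times a small step from \<open>z\<close> in direction \<open>v\<close> would come closer to \<open>x\<close>, which contradicts
  that \<open>z\<close> is the centre along \<open>H\<close>.\<close>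

lemma opial_halfspaces:
  fixes x :: "'b \<Rightarrow> 'a::{real_inner,complete_space}"
  assumes S: "S = {z. \<forall>(a, b)\<in>G. (z - a) \<bullet> b \<le> 0}" and ne: "S \<noteq> {}" and F: "F \<noteq> bot"
    and lim: "\<And>z. z \<in> S \<Longrightarrow> \<exists>l. ((\<lambda>t. (norm (x t - z))\<^sup>2) \<longlongrightarrow> l) F"
    and asym: "\<And>a b e. (a, b) \<in> G \<Longrightarrow> e > 0 \<Longrightarrow> eventually (\<lambda>t. (x t - a) \<bullet> b \<le> e) F"
  shows "\<exists>z\<in>S. weakly_tendsto x z F"
proof -
  define centre where "centre H z \<longleftrightarrow>
    (\<forall>y d. d > 0 \<longrightarrow> \<not> eventually (\<lambda>t. (norm (x t - y))\<^sup>2 \<le> (norm (x t - z))\<^sup>2 - d) H)" for H z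
  obtain M where M: "eventually (\<lambda>t. norm (x t) \<le> M) F"
    using ne lim eventually_bounded_of_distance_tendsto by blast
  have ex: "\<exists>z\<in>S. centre H z" if H: "H \<le> F" "H \<noteq> bot" for H
  proof -
    obtain z where z: "centre H z"
      by (rule asymptotic_centre_exists[OF H(2) filter_leD[OF H(1) M]]) (unfold centre_def, blast)
    have "(z - a) \<bullet> b \<le> 0" if ab: "(a, b) \<in> G" for a b
    proof (rule ccontr)
      assume "\<not> (z - a) \<bullet> b \<le> 0"
      hence pos: "0 < (z - a) \<bullet> b" by simp
      hence b: "0 < b \<bullet> b" by auto
      \<comment> \<open>The projection of \<open>z\<close> onto the halfspace is \<open>z - s b\<close>; half of the gain
        \<open>s\<^sup>2 \<parallel>b\<parallel>\<^sup>2\<close> absorbs the asymptotic error.\<close>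
      define s where "s = (z - a) \<bullet> b / (b \<bullet> b)"
      have s: "0 < s" using pos b by (simp add: s_def)
      have sb: "(z - a) \<bullet> b = s * (b \<bullet> b)" using b by (simp add: s_def)
      define d where "d = s\<^sup>2 * (b \<bullet> b) / 2"
      have d: "0 < d" using s b by (simp add: d_def)
      have "eventually (\<lambda>t. (x t - a) \<bullet> b \<le> d / (2 * s)) F" using asym[OF ab] d s by simp
      hence "eventually (\<lambda>t. (x t - a) \<bullet> b \<le> d / (2 * s)) H" by (rule filter_leD[OF H(1)])
      hence "eventually (\<lambda>t. (norm (x t - (z - s *\<^sub>R b)))\<^sup>2 \<le> (norm (x t - z))\<^sup>2 - d) H"
      proof eventually_elim
        case (elim t)
        have "(norm (x t - (z - s *\<^sub>R b)))\<^sup>2 = (norm (x t - z))\<^sup>2 + 2 * s * ((x t - a) \<bullet> b - (z - a) \<bullet> b) + s\<^sup>2 * (b \<bullet> b)"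
          unfolding power2_norm_eq_inner
          by (simp add: inner_diff_left inner_diff_right inner_commute power2_eq_square algebra_simps)
        also have "\<dots> = (norm (x t - z))\<^sup>2 + 2 * s * ((x t - a) \<bullet> b) - 2 * d"
          unfolding sb d_def by (simp add: power2_eq_square algebra_simps)
        also have "\<dots> \<le> (norm (x t - z))\<^sup>2 - d"
          using elim s by (simp add: field_simps)
        finally show ?case .
      qed
      thus False using z d unfolding centre_def by blast
    qed
    hence "z \<in> S" unfolding S by blast
    thus ?thesis using z by blast
  qed
  have uniq: "z' = z" if z: "z \<in> S" "centre F z" and z': "z' \<in> S" "centre H z'" and H: "H \<le> F" for z z' H
  proof (rule ccontr)
    assume neq: "z' \<noteq> z"
    obtain l l' where l: "((\<lambda>t. (norm (x t - z))\<^sup>2) \<longlongrightarrow> l) F" "((\<lambda>t. (norm (x t - z'))\<^sup>2) \<longlongrightarrow> l') F"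
      using lim z(1) z'(1) by metis
    have diff: "((\<lambda>t. (norm (x t - z))\<^sup>2 - (norm (x t - z'))\<^sup>2) \<longlongrightarrow> l - l') F"
      by (intro tendsto_intros l)
    consider "l' < l" | "l < l'" | "l = l'" by linarith
    thus False
    proof cases
      case 1
      have "eventually (\<lambda>t. (norm (x t - z))\<^sup>2 - (norm (x t - z'))\<^sup>2 > (l - l') / 2) F"
        using diff 1 by (intro order_tendstoD) auto
      hence "eventually (\<lambda>t. (norm (x t - z'))\<^sup>2 \<le> (norm (x t - z))\<^sup>2 - (l - l') / 2) F"
        by eventually_elim linarith
      moreover have "(l - l') / 2 > 0" using 1 by simp
      ultimately show False using z(2) unfolding centre_def by blast
    next
      case 2
      have "eventually (\<lambda>t. (norm (x t - z))\<^sup>2 - (norm (x t - z'))\<^sup>2 < (l - l') / 2) F"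
        using diff 2 by (intro order_tendstoD) auto
      hence "eventually (\<lambda>t. (norm (x t - z))\<^sup>2 \<le> (norm (x t - z'))\<^sup>2 - (l' - l) / 2) F"
        by eventually_elim argo
      hence "eventually (\<lambda>t. (norm (x t - z))\<^sup>2 \<le> (norm (x t - z'))\<^sup>2 - (l' - l) / 2) H"
        by (rule filter_leD[OF H])
      moreover have "(l' - l) / 2 > 0" using 2 by simp
      ultimately show False using z'(2) unfolding centre_def by blast
    next
      case 3
      \<comment> \<open>Two equally good points: their midpoint is closer by \<open>\<parallel>z - z'\<parallel>\<^sup>2 / 4\<close>.\<close>
      define d where "d = (norm (z - z'))\<^sup>2 / 8"
      have d: "d > 0" using neq by (simp add: d_def)
      have "eventually (\<lambda>t. (norm (x t - z))\<^sup>2 - (norm (x t - z'))\<^sup>2 > - d) F"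
        using diff 3 d by (intro order_tendstoD) auto
      hence "eventually (\<lambda>t. (norm (x t - (1/2) *\<^sub>R (z + z')))\<^sup>2 \<le> (norm (x t - z))\<^sup>2 - d) F"
        unfolding norm_midpoint_sq
      proof eventually_elim
        case (elim t)
        have "(norm (z - z'))\<^sup>2 / 4 = 2 * d" by (simp add: d_def)
        thus ?case using elim d by argo
      qed
      thus False using z(2) d unfolding centre_def by blast
    qed
  qed
  obtain z where z: "z \<in> S" "centre F z" using ex[of F] F by blast
  have ev: "eventually (\<lambda>t. (x t - z) \<bullet> v < e) F" if e: "e > 0" for v e
  proof (rule ccontr)
    assume not: "\<not> ?thesis"
    define H where "H = inf F (principal {t. e \<le> (x t - z) \<bullet> v})"
    have "H \<noteq> bot"
    proof
      assume "H = bot"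
      hence "eventually (\<lambda>t. False) H" by simp
      hence "eventually (\<lambda>t. (x t - z) \<bullet> v < e) F"
        unfolding H_def eventually_inf_principal by (simp add: not_le)
      thus False using not by simp
    qed
    moreover have H: "H \<le> F" by (simp add: H_def)
    ultimately have c: "centre H z" using ex uniq[OF z] by blast
    have evH: "eventually (\<lambda>t. e \<le> (x t - z) \<bullet> v) H"
      unfolding H_def eventually_inf_principal by simp
    have "v \<noteq> 0"
    proof
      assume "v = 0"
      hence "eventually (\<lambda>t. (x t - z) \<bullet> v < e) F" using e by simp
      thus False using not by simp
    qed
    hence v: "v \<bullet> v > 0" by simp
    define s where "s = e / (v \<bullet> v)"
    have s: "s > 0" using e v by (simp add: s_def)
    have "eventually (\<lambda>t. (norm (x t - (z + s *\<^sub>R v)))\<^sup>2 \<le> (norm (x t - z))\<^sup>2 - s * e) H"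
      using evH
    proof eventually_elim
      case (elim t)
      have "(norm (x t - (z + s *\<^sub>R v)))\<^sup>2 = (norm (x t - z))\<^sup>2 - 2 * s * ((x t - z) \<bullet> v) + s * (s * (v \<bullet> v))"
        unfolding power2_norm_eq_inner
        by (simp add: inner_diff_left inner_diff_right inner_add_left inner_add_right inner_commute algebra_simps)
      also have "s * (v \<bullet> v) = e" using v by (simp add: s_def)
      also have "(norm (x t - z))\<^sup>2 - 2 * s * ((x t - z) \<bullet> v) + s * e \<le> (norm (x t - z))\<^sup>2 - s * e"
        using mult_left_mono[OF elim, of s] s by (simp add: algebra_simps)
      finally show ?case .
    qed
    thus False using c s e unfolding centre_def by (meson mult_pos_pos)
  qed
  have "weakly_tendsto x z F"
    unfolding weakly_tendsto_def
  proof (intro allI impI)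
    fix \<phi> :: "'a \<Rightarrow> real" assume "bounded_linear \<phi>"
    then obtain v where v: "\<And>y. \<phi> y = v \<bullet> y" using riesz_representation by blast
    show "((\<lambda>t. \<phi> (x t)) \<longlongrightarrow> \<phi> z) F"
    proof (rule tendstoI)
      fix e :: real assume "e > 0"
      hence "eventually (\<lambda>t. (x t - z) \<bullet> v < e) F" "eventually (\<lambda>t. (x t - z) \<bullet> - v < e) F"
        using ev by blast+
      thus "eventually (\<lambda>t. dist (\<phi> (x t)) (\<phi> z) < e) F"
        by eventually_elim (simp add: v dist_real_def inner_diff_left inner_commute[of v] abs_less_iff)
    qed
  qed
  thus ?thesis using z(1) by blast
qed

section \<open>The energy of the inertial dynamics\<close>

lemma nonincreasing_tendsto_at_top:
  fixes f f' :: "real \<Rightarrow> real"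
  assumes der: "\<And>t. t > a \<Longrightarrow> (f has_real_derivative f' t) (at t)"
    and neg: "\<And>t. t > a \<Longrightarrow> f' t \<le> 0" and low: "\<And>t. t > a \<Longrightarrow> m \<le> f t"
  obtains l where "(f \<longlongrightarrow> l) at_top"
proof -
  define l where "l = (INF t\<in>{a<..}. f t)"
  have bdd: "bdd_below (f ` {a<..})" using low by (auto intro!: bdd_belowI)
  have anti: "f t \<le> f s" if "a < s" "s \<le> t" for s t
  proof (rule DERIV_nonpos_imp_nonincreasing[OF that(2)])
    fix r assume "s \<le> r" "r \<le> t"
    thus "\<exists>y. (f has_real_derivative y) (at r) \<and> y \<le> 0"
      using der[of r] neg[of r] that(1) by (intro exI[of _ "f' r"]) auto
  qed
  have "(f \<longlongrightarrow> l) at_top"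
  proof (rule order_tendstoI)
    fix y assume "y < l"
    show "eventually (\<lambda>t. y < f t) at_top"
      using eventually_gt_at_top[of a]
    proof eventually_elim
      case (elim t)
      have "l \<le> f t" unfolding l_def using bdd elim by (intro cINF_lower) auto
      thus ?case using \<open>y < l\<close> by linarith
    qed
  next
    fix y assume "l < y"
    then obtain s where s: "s > a" "f s < y"
      unfolding l_def using cINF_less_iff[OF _ bdd] by auto
    show "eventually (\<lambda>t. f t < y) at_top"
      using eventually_ge_at_top[of s] by eventually_elim (use anti s in fastforce)
  qed
  thus ?thesis using that by blast
qed

text \<open>The assumption \<open>coc\<close> is cocoercivity of the Yosida term with that term replaced, through the
  equation, by \<open>- (x'' + (\<alpha>/t) x')\<close>. Everything is read off from the energy \<open>W\<close> and its dissipation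
  \<open>t \<parallel>x'\<parallel>\<^sup>2 + t\<^sup>3 \<parallel>x''\<parallel>\<^sup>2\<close>, which is at most \<open>- W' / \<kappa>\<close>. Besides \<open>W\<close>, also
  \<open>P = t\<^sup>2 \<parallel>x'\<parallel>\<^sup>2\<close> has a limit, as \<open>P'\<close> is at most three times the dissipation and so
  \<open>P + (3/\<kappa>) W\<close> is nonincreasing; the limit of \<open>P\<close> is 0 because the third conclusion makes \<open>P\<close> small
  at arbitrarily late times \<open>s\<close>. Once \<open>P\<close> and the cross term of \<open>W\<close> vanish in the limit, convergence of
  \<open>W\<close> is convergence of the distance to \<open>z\<close>.\<close>

lemma inertial_energy_estimates:
  fixes x x' x'' :: "real \<Rightarrow> 'a::real_inner" and z :: 'a and t0 \<alpha> \<epsilon> :: real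
  assumes t0: "t0 > 0" and \<alpha>: "\<alpha> > 2" and \<epsilon>: "\<epsilon> > 2 / (\<alpha> - 2)"
    and dx: "\<And>t. t > t0 \<Longrightarrow> (x has_vector_derivative x' t) (at t)"
    and dx': "\<And>t. t > t0 \<Longrightarrow> (x' has_vector_derivative x'' t) (at t)"
    and coc: "\<And>t. t > t0 \<Longrightarrow> (1 + \<epsilon>) * t\<^sup>2 / \<alpha>\<^sup>2 * (norm (x'' t + (\<alpha> / t) *\<^sub>R x' t))\<^sup>2
                \<le> - ((x'' t + (\<alpha> / t) *\<^sub>R x' t) \<bullet> (x t - z))"
  shows "\<exists>l. ((\<lambda>t. (norm (x t - z))\<^sup>2) \<longlongrightarrow> l) at_top"
    and "((\<lambda>t. t * norm (x' t)) \<longlongrightarrow> 0) at_top"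
    and "\<exists>D. (D \<longlongrightarrow> 0) at_top \<and> (\<forall>t>t0. \<exists>s>t. s < 2 * t \<and> s * norm (x' s) \<le> D t \<and> s\<^sup>2 * norm (x'' s) \<le> D t)"
proof -
  define c where "c = (1 + \<epsilon>) / \<alpha>"
  define X where "X t = x t - z" for t
  define W where "W t = t * (x' t \<bullet> X t) + (\<alpha> - 1) / 2 * (X t \<bullet> X t) + c * t\<^sup>2 * (x' t \<bullet> x' t)" for t
  define W' where "W' t = \<alpha> * (x' t \<bullet> X t) + t * (x'' t \<bullet> X t) + t * (x' t \<bullet> x' t) + 2 * c * t * (x' t \<bullet> x' t)
     + 2 * c * t\<^sup>2 * (x' t \<bullet> x'' t)" for t
  define P where "P t = t\<^sup>2 * (x' t \<bullet> x' t)" for t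
  define P' where "P' t = 2 * t * (x' t \<bullet> x' t) + 2 * t\<^sup>2 * (x' t \<bullet> x'' t)" for t
  define \<kappa> where "\<kappa> = min (\<epsilon> - 2 * c) ((1 + \<epsilon>) / \<alpha>\<^sup>2)"
  have \<epsilon>0: "\<epsilon> > 0" using \<alpha> \<epsilon> by (smt (verit) divide_pos_pos)
  have \<epsilon>\<alpha>: "2 < \<epsilon> * (\<alpha> - 2)" using \<epsilon> \<alpha> by (simp add: divide_less_eq)
  have gap: "\<epsilon> - 2 * c > 0" using \<epsilon>\<alpha> \<alpha> by (simp add: c_def field_simps)
  have \<kappa>: "\<kappa> > 0" using gap \<epsilon>0 \<alpha> by (simp add: \<kappa>_def)
  \<comment> \<open>This bound lets \<open>c t\<^sup>2 \<parallel>x'\<parallel>\<^sup>2\<close> and half of \<open>(\<alpha> - 1) / 2 \<parallel>x - z\<parallel>\<^sup>2\<close> absorb the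
    cross term of \<open>W\<close>; the other half controls the distance to \<open>z\<close>.\<close>
  have c_gt: "c > 1 / (\<alpha> - 1)"
  proof -
    have "c * \<alpha> = 1 + \<epsilon>" using \<alpha> by (simp add: c_def)
    hence "(c * \<alpha>) * (\<alpha> - 2) > \<alpha>" using \<epsilon>\<alpha> by (simp add: algebra_simps)
    hence "\<alpha> * (c * (\<alpha> - 2)) > \<alpha> * 1" by (simp add: algebra_simps)
    hence "c * (\<alpha> - 2) > 1" using \<alpha> by (subst (asm) mult_less_cancel_left_pos) auto
    moreover have "c > 0" using \<epsilon>0 \<alpha> by (simp add: c_def)
    ultimately have "c * (\<alpha> - 1) > 1" by (simp add: algebra_simps)
    thus ?thesis using \<alpha> by (simp add: divide_less_eq)
  qed
  have dX: "(X has_vector_derivative x' t) (at t)" if "t > t0" for t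
    unfolding X_def using dx[OF that] by (auto intro!: derivative_eq_intros)
  have inner_der: "((\<lambda>t. u t \<bullet> v t) has_real_derivative (u t \<bullet> v' + u' \<bullet> v t)) (at t)"
    if "(u has_vector_derivative u') (at t)" "(v has_vector_derivative v') (at t)" for u v :: "real \<Rightarrow> 'a" and u' v' t
    unfolding has_field_derivative_def
    by (rule has_derivative_eq_rhs[OF has_derivative_inner[OF that[unfolded has_vector_derivative_def]]])
      (auto simp: algebra_simps)
  have dW: "(W has_real_derivative W' t) (at t)" if "t > t0" for t
    unfolding W_def
    by (rule derivative_eq_intros refl inner_der dX dx' that)+
      (simp add: W'_def inner_commute field_simps power2_eq_square)
  have dP: "(P has_real_derivative P' t) (at t)" if "t > t0" for t
    unfolding P_def
    by (rule derivative_eq_intros refl inner_der dX dx' that)+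
      (simp add: P'_def inner_commute algebra_simps power2_eq_square)
  have W'_le: "W' t \<le> - \<kappa> * (t * (norm (x' t))\<^sup>2 + t ^ 3 * (norm (x'' t))\<^sup>2)" if t: "t > t0" for t
  proof -
    have tp: "t > 0" using t t0 by simp
    define w where "w = x'' t + (\<alpha> / t) *\<^sub>R x' t"
    have "\<alpha> * (x' t \<bullet> X t) + t * (x'' t \<bullet> X t) = t * (w \<bullet> X t)"
      using tp by (simp add: w_def inner_add_left field_simps)
    also have "\<dots> \<le> t * - ((1 + \<epsilon>) * t\<^sup>2 / \<alpha>\<^sup>2 * (norm w)\<^sup>2)"
      using coc[OF t] tp unfolding X_def w_def by (intro mult_left_mono) auto
    also have "(norm w)\<^sup>2 = x'' t \<bullet> x'' t + 2 * (\<alpha> / t) * (x' t \<bullet> x'' t) + (\<alpha> / t)\<^sup>2 * (x' t \<bullet> x' t)"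
      unfolding w_def power2_norm_eq_inner
      by (simp add: inner_add_left inner_add_right inner_commute power2_eq_square algebra_simps)
    also have "t * - ((1 + \<epsilon>) * t\<^sup>2 / \<alpha>\<^sup>2 * \<dots>)
       = - ((1 + \<epsilon>) / \<alpha>\<^sup>2) * (t ^ 3 * (x'' t \<bullet> x'' t)) - 2 * c * t\<^sup>2 * (x' t \<bullet> x'' t) - (1 + \<epsilon>) * (t * (x' t \<bullet> x' t))"
      using tp \<alpha> by (simp add: c_def field_simps power2_eq_square power3_eq_cube)
    finally have "W' t \<le> - (\<epsilon> - 2 * c) * (t * (x' t \<bullet> x' t)) - ((1 + \<epsilon>) / \<alpha>\<^sup>2) * (t ^ 3 * (x'' t \<bullet> x'' t))"
      unfolding W'_def by (simp add: algebra_simps)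
    moreover have "\<kappa> * (t * (x' t \<bullet> x' t)) \<le> (\<epsilon> - 2 * c) * (t * (x' t \<bullet> x' t))"
      using tp by (intro mult_right_mono) (auto simp: \<kappa>_def)
    moreover have "\<kappa> * (t ^ 3 * (x'' t \<bullet> x'' t)) \<le> ((1 + \<epsilon>) / \<alpha>\<^sup>2) * (t ^ 3 * (x'' t \<bullet> x'' t))"
      using tp by (intro mult_right_mono) (auto simp: \<kappa>_def)
    ultimately show ?thesis unfolding power2_norm_eq_inner by (simp add: algebra_simps)
  qed
  have W'_neg: "W' t \<le> 0" if t: "t > t0" for t
  proof -
    have "0 \<le> \<kappa> * (t * (norm (x' t))\<^sup>2 + t ^ 3 * (norm (x'' t))\<^sup>2)" using t t0 \<kappa> by simp
    thus ?thesis using W'_le[OF t] by linarith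
  qed
  have P_norm: "P t = (t * norm (x' t))\<^sup>2" for t
    by (simp add: P_def power2_norm_eq_inner power_mult_distrib)
  have W_ge: "(\<alpha> - 1) / 4 * (norm (X t))\<^sup>2 \<le> W t" if t: "t > t0" for t
  proof -
    define p where "p = t * norm (x' t)"
    define n where "n = norm (X t)"
    have a1: "\<alpha> - 1 > 0" using \<alpha> by simp
    have "- (x' t \<bullet> X t) \<le> norm (x' t) * norm (X t)"
      using norm_cauchy_schwarz[of "x' t" "- X t"] by simp
    hence "t * - (x' t \<bullet> X t) \<le> t * (norm (x' t) * norm (X t))"
      using t t0 by (intro mult_left_mono) auto
    hence 1: "- (t * (x' t \<bullet> X t)) \<le> p * n" by (simp add: p_def n_def mult.assoc)
    have "0 \<le> (p - (\<alpha> - 1) / 2 * n)\<^sup>2 / (\<alpha> - 1)" using a1 by simp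
    also have "\<dots> = p\<^sup>2 / (\<alpha> - 1) + (\<alpha> - 1) / 4 * n\<^sup>2 - p * n"
      using a1 by (simp add: field_simps power2_eq_square)
    finally have 2: "p * n \<le> p\<^sup>2 / (\<alpha> - 1) + (\<alpha> - 1) / 4 * n\<^sup>2" by simp
    have 3: "p\<^sup>2 / (\<alpha> - 1) \<le> c * p\<^sup>2"
      using mult_right_mono[OF less_imp_le[OF c_gt], of "p\<^sup>2"] by simp
    have "W t = t * (x' t \<bullet> X t) + (\<alpha> - 1) / 2 * n\<^sup>2 + c * p\<^sup>2"
      by (simp add: W_def n_def p_def power2_norm_eq_inner power_mult_distrib)
    thus ?thesis using 1 2 3 unfolding n_def[symmetric] by argo
  qed
  have W0: "0 \<le> W t" if "t > t0" for t
    using W_ge[OF that] \<alpha> by (smt (verit) mult_nonneg_nonneg divide_nonneg_pos zero_le_power2)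
  obtain L where L: "(W \<longlongrightarrow> L) at_top"
    using nonincreasing_tendsto_at_top[of t0 W W' 0] dW W'_neg W0 by blast
  have P0: "0 \<le> P t" for t by (simp add: P_norm)
  have P'_le: "P' t + 3 / \<kappa> * W' t \<le> 0" if t: "t > t0" for t
  proof -
    have tp: "t > 0" using t t0 by simp
    \<comment> \<open>Young's inequality, with the weight that matches the dissipation.\<close>
    have "2 * t\<^sup>2 * (x' t \<bullet> x'' t) \<le> t * (x' t \<bullet> x' t) + t ^ 3 * (x'' t \<bullet> x'' t)"
    proof -
      have "0 \<le> t * ((x' t - t *\<^sub>R x'' t) \<bullet> (x' t - t *\<^sub>R x'' t))" using tp by simp
      also have "\<dots> = t * (x' t \<bullet> x' t) + t ^ 3 * (x'' t \<bullet> x'' t) - 2 * t\<^sup>2 * (x' t \<bullet> x'' t)"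
        by (simp add: inner_diff_left inner_diff_right inner_commute power2_eq_square power3_eq_cube algebra_simps)
      finally show ?thesis by simp
    qed
    moreover have "0 \<le> t ^ 3 * (x'' t \<bullet> x'' t)" using tp by simp
    ultimately have "P' t \<le> 3 * (t * (norm (x' t))\<^sup>2 + t ^ 3 * (norm (x'' t))\<^sup>2)"
      unfolding P'_def power2_norm_eq_inner by argo
    also have "\<dots> \<le> - (3 / \<kappa>) * W' t"
      using W'_le[OF t] \<kappa> by (simp add: field_simps)
    finally show ?thesis by simp
  qed
  obtain L2 where L2: "((\<lambda>t. P t + 3 / \<kappa> * W t) \<longlongrightarrow> L2) at_top"
  proof (rule nonincreasing_tendsto_at_top[of t0 "\<lambda>t. P t + 3 / \<kappa> * W t" "\<lambda>t. P' t + 3 / \<kappa> * W' t" 0])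
    show "0 \<le> P t + 3 / \<kappa> * W t" if "t > t0" for t using P0[of t] W0[OF that] \<kappa> by simp
    show "((\<lambda>t. P t + 3 / \<kappa> * W t) has_real_derivative P' t + 3 / \<kappa> * W' t) (at t)" if "t > t0" for t
      by (intro DERIV_add DERIV_cmult dP dW that)
  qed (use P'_le in auto)
  define p where "p = L2 - 3 / \<kappa> * L"
  have Pp: "(P \<longlongrightarrow> p) at_top"
  proof -
    have "((\<lambda>t. P t + 3 / \<kappa> * W t - 3 / \<kappa> * W t) \<longlongrightarrow> p) at_top"
      unfolding p_def by (intro tendsto_intros L L2)
    thus ?thesis by simp
  qed
  define E where "E t = 2 / \<kappa> * (W t - W (2 * t))" for t
  have E0: "(E \<longlongrightarrow> 0) at_top"
  proof -
    have "filterlim (\<lambda>t::real. 2 * t) at_top at_top"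
      by (rule filterlim_tendsto_pos_mult_at_top[OF tendsto_const _ filterlim_ident]) simp
    hence "((\<lambda>t. W (2 * t)) \<longlongrightarrow> L) at_top" using L filterlim_compose by blast
    hence "(E \<longlongrightarrow> 2 / \<kappa> * (L - L)) at_top" unfolding E_def by (intro tendsto_intros L)
    thus ?thesis by simp
  qed
  \<comment> \<open>The interval \<open>[t, 2 t]\<close> has length \<open>t\<close>, so \<open>t W' s\<close> equals an increment of \<open>W\<close> that tends to
    0; the factor 2 in \<open>E\<close> turns \<open>t\<close> into \<open>s < 2 t\<close>.\<close>
  have mvt: "\<exists>s>t. s < 2 * t \<and> (s * norm (x' s))\<^sup>2 + (s\<^sup>2 * norm (x'' s))\<^sup>2 \<le> E t" if t: "t > t0" for t
  proof -
    have tp: "t > 0" using t t0 by simp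
    obtain s where s: "t < s" "s < 2 * t" "W (2 * t) - W t = (2 * t - t) * W' s"
      using MVT2[of t "2 * t" W W'] dW t tp by auto
    have "\<kappa> * ((s * norm (x' s))\<^sup>2 + (s\<^sup>2 * norm (x'' s))\<^sup>2)
        = s * (\<kappa> * (s * (norm (x' s))\<^sup>2 + s ^ 3 * (norm (x'' s))\<^sup>2))"
      by (simp add: power2_eq_square power3_eq_cube algebra_simps)
    also have "\<dots> \<le> s * (- W' s)"
      using W'_le[of s] s t tp by (intro mult_left_mono) auto
    also have "\<dots> \<le> (2 * t) * (- W' s)"
      using W'_neg[of s] s t by (intro mult_right_mono) auto
    also have "\<dots> = 2 * (W t - W (2 * t))" using s(3) by simp
    finally have "(s * norm (x' s))\<^sup>2 + (s\<^sup>2 * norm (x'' s))\<^sup>2 \<le> E t"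
      using \<kappa> by (simp add: E_def field_simps)
    thus ?thesis using s by blast
  qed
  have p: "p = 0"
  proof -
    obtain s where s: "\<And>t. t > t0 \<Longrightarrow> s t > t" "\<And>t. t > t0 \<Longrightarrow> (s t * norm (x' (s t)))\<^sup>2 + ((s t)\<^sup>2 * norm (x'' (s t)))\<^sup>2 \<le> E t"
      using mvt by metis
    have "filterlim s at_top at_top"
      by (rule filterlim_at_top_mono[OF filterlim_ident])
        (rule eventually_mono[OF eventually_gt_at_top[of t0]], rule less_imp_le, rule s(1))
    hence "((\<lambda>t. P (s t)) \<longlongrightarrow> p) at_top" using Pp filterlim_compose by blast
    moreover have "((\<lambda>t. P (s t)) \<longlongrightarrow> 0) at_top"
    proof (rule tendsto_sandwich[OF _ _ tendsto_const E0])
      show "eventually (\<lambda>t. 0 \<le> P (s t)) at_top" using P0 by simp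
      show "eventually (\<lambda>t. P (s t) \<le> E t) at_top"
        using eventually_gt_at_top[of t0]
      proof eventually_elim
        case (elim t)
        show ?case using s(2)[OF elim] unfolding P_norm by (smt (verit) zero_le_power2)
      qed
    qed
    ultimately show ?thesis using tendsto_unique trivial_limit_at_top_linorder by blast
  qed
  have tx'_sqrt: "((\<lambda>t. sqrt (P t)) \<longlongrightarrow> 0) at_top"
    using tendsto_real_sqrt[OF Pp] p by simp
  show tx': "((\<lambda>t. t * norm (x' t)) \<longlongrightarrow> 0) at_top"
    using tx'_sqrt
    by (rule Lim_transform_eventually) (rule eventually_mono[OF eventually_gt_at_top[of 0]], simp add: P_norm)
  show "\<exists>D. (D \<longlongrightarrow> 0) at_top \<and> (\<forall>t>t0. \<exists>s>t. s < 2 * t \<and> s * norm (x' s) \<le> D t \<and> s\<^sup>2 * norm (x'' s) \<le> D t)"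
  proof -
    have "\<exists>s>t. s < 2 * t \<and> s * norm (x' s) \<le> sqrt (E t) \<and> s\<^sup>2 * norm (x'' s) \<le> sqrt (E t)" if t: "t > t0" for t
    proof -
      obtain s where s: "s > t" "s < 2 * t" "(s * norm (x' s))\<^sup>2 + (s\<^sup>2 * norm (x'' s))\<^sup>2 \<le> E t"
        using mvt[OF t] by blast
      have "s * norm (x' s) \<le> sqrt (E t)" "s\<^sup>2 * norm (x'' s) \<le> sqrt (E t)"
        by (rule real_le_rsqrt, use s(3) in \<open>smt (verit) zero_le_power2\<close>)+
      thus ?thesis using s by blast
    qed
    moreover have "((\<lambda>t. sqrt (E t)) \<longlongrightarrow> 0) at_top" using tendsto_real_sqrt[OF E0] by simp
    ultimately show ?thesis by blast
  qed
  obtain B where B: "eventually (\<lambda>t. norm (X t) \<le> B) at_top"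
  proof -
    have a1: "\<alpha> - 1 > 0" using \<alpha> by simp
    have "eventually (\<lambda>t. W t < L + 1) at_top" using L by (intro order_tendstoD) auto
    hence "eventually (\<lambda>t. norm (X t) \<le> sqrt (4 * (L + 1) / (\<alpha> - 1))) at_top"
      using eventually_gt_at_top[of t0]
    proof eventually_elim
      case (elim t)
      have "(\<alpha> - 1) / 4 * (norm (X t))\<^sup>2 \<le> L + 1" using W_ge[OF elim(2)] elim(1) by simp
      hence "(norm (X t))\<^sup>2 \<le> 4 * (L + 1) / (\<alpha> - 1)" using a1 by (simp add: field_simps)
      thus ?case by (rule real_le_rsqrt)
    qed
    thus ?thesis using that by blast
  qed
  have cross: "((\<lambda>t. t * (x' t \<bullet> X t)) \<longlongrightarrow> 0) at_top"
  proof (rule Lim_null_comparison)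
    show "((\<lambda>t. (t * norm (x' t)) * B) \<longlongrightarrow> 0) at_top" using tendsto_mult_right[OF tx', of B] by simp
    show "eventually (\<lambda>t. norm (t * (x' t \<bullet> X t)) \<le> (t * norm (x' t)) * B) at_top"
      using B eventually_gt_at_top[of 0]
    proof eventually_elim
      case (elim t)
      have "norm (t * (x' t \<bullet> X t)) \<le> t * (norm (x' t) * norm (X t))"
        using elim(2) Cauchy_Schwarz_ineq2[of "x' t" "X t"] by (simp add: abs_mult mult_left_mono)
      also have "\<dots> \<le> t * (norm (x' t) * B)" using elim by (intro mult_left_mono) auto
      finally show ?case by (simp add: algebra_simps)
    qed
  qed
  have "((\<lambda>t. 2 / (\<alpha> - 1) * (W t - t * (x' t \<bullet> X t) - c * P t)) \<longlongrightarrow> 2 / (\<alpha> - 1) * (L - 0 - c * p)) at_top"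
    by (intro tendsto_intros L cross Pp)
  moreover have "2 / (\<alpha> - 1) * (W t - t * (x' t \<bullet> X t) - c * P t) = (norm (x t - z))\<^sup>2" for t
    using \<alpha> by (simp add: W_def P_def X_def power2_norm_eq_inner)
  ultimately show "\<exists>l. ((\<lambda>t. (norm (x t - z))\<^sup>2) \<longlongrightarrow> l) at_top" by auto
qed

section \<open>Convergence of the trajectory\<close>

theorem theorem2p1:
  fixes A :: "'a::{real_inner,complete_space} \<Rightarrow> 'a set"
    and t0 \<alpha> \<epsilon> :: real
    and lam :: "real \<Rightarrow> real"
    and x x' x'' :: "real \<Rightarrow> 'a"
  assumes "maximally_monotone A"
    and "operator_inverse A 0 \<noteq> {}"
    and "t0 > 0"
    and "\<alpha> > 2"
    and "\<epsilon> > 2 / (\<alpha> - 2)"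
    and "\<And>t. lam t = (1 + \<epsilon>) * t\<^sup>2 / \<alpha>\<^sup>2"
    and "C2_from t0 x x' x''"
    and "\<And>t. t > t0 \<Longrightarrow> x'' t + (\<alpha> / t) *\<^sub>R x' t + yosida (lam t) A (x t) = 0"
  shows "(\<exists>z \<in> operator_inverse A 0. weakly_tendsto x z at_top)
    \<and> ((\<lambda>t. norm (x' t)) \<longlongrightarrow> 0) at_top
    \<and> ((\<lambda>t. norm (x'' t)) \<longlongrightarrow> 0) at_top"
proof -
  note A = assms(1) and t0 = assms(3) and \<alpha> = assms(4) and \<epsilon> = assms(5)
  have \<epsilon>0: "\<epsilon> > 0" using \<alpha> \<epsilon> by (smt (verit) divide_pos_pos)
  define S where "S = operator_inverse A 0"
  define c where "c = (1 + \<epsilon>) / \<alpha>\<^sup>2"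
  have c: "c > 0" using \<epsilon>0 \<alpha> by (simp add: c_def)
  have lam: "lam t = c * t\<^sup>2" for t by (simp add: assms(6) c_def)
  have lam_pos: "lam t > 0" if "t > t0" for t using that t0 c by (simp add: lam)
  define w where "w t = yosida (lam t) A (x t)" for t
  have w: "w t = - (x'' t + (\<alpha> / t) *\<^sub>R x' t)" if "t > t0" for t
    using assms(8)[OF that] unfolding w_def by (simp add: add_eq_0_iff)
  have within: "at t within {t0..} = at t" if "t > t0" for t
    by (rule at_within_interior) (use that in auto)
  have dx: "(x has_vector_derivative x' t) (at t)" if "t > t0" for t
    using assms(7) that within[OF that] unfolding C2_from_def by (metis less_imp_le)
  have dx': "(x' has_vector_derivative x'' t) (at t)" if "t > t0" for t
    using assms(7) that within[OF that] unfolding C2_from_def by (metis less_imp_le)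
  have coc: "lam t * (norm (w t))\<^sup>2 \<le> w t \<bullet> (x t - z)" if "t > t0" "z \<in> S" for t z
    unfolding w_def using that A lam_pos
    by (intro yosida_cocoercive_at_zero) (auto simp: S_def operator_inverse_def)
  have coc': "(1 + \<epsilon>) * t\<^sup>2 / \<alpha>\<^sup>2 * (norm (x'' t + (\<alpha> / t) *\<^sub>R x' t))\<^sup>2
      \<le> - ((x'' t + (\<alpha> / t) *\<^sub>R x' t) \<bullet> (x t - z))" if "t > t0" "z \<in> S" for t z
    using coc[OF that] unfolding w[OF that(1)] assms(6) by (simp only: norm_minus_cancel inner_minus_left)
  note est = inertial_energy_estimates[OF t0 \<alpha> \<epsilon> dx dx' coc']
  obtain z0 where z0: "z0 \<in> S" using assms(2) by (auto simp: S_def)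
  have tx': "((\<lambda>t. t * norm (x' t)) \<longlongrightarrow> 0) at_top" using est(2) z0 by blast
  obtain D where D: "(D \<longlongrightarrow> 0) at_top"
    and Ds: "\<And>t. t > t0 \<Longrightarrow> \<exists>s>t. s < 2 * t \<and> s * norm (x' s) \<le> D t \<and> s\<^sup>2 * norm (x'' s) \<le> D t"
    using est(3)[OF _ _ _ z0] by blast
  obtain M where M: "eventually (\<lambda>t. norm (x t) \<le> M) at_top"
    using est(1) z0 eventually_bounded_of_distance_tendsto by blast
  have inv: "((\<lambda>t::real. 1 / t) \<longlongrightarrow> 0) at_top"
    using tendsto_inverse_0_at_top[OF filterlim_ident] by (simp add: inverse_eq_divide)
  have x'0: "((\<lambda>t. norm (x' t)) \<longlongrightarrow> 0) at_top"
  proof (rule Lim_transform_eventually)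
    show "((\<lambda>t. 1 / t * (t * norm (x' t))) \<longlongrightarrow> 0) at_top" using tendsto_mult[OF inv tx'] by simp
    show "eventually (\<lambda>t. 1 / t * (t * norm (x' t)) = norm (x' t)) at_top"
      using eventually_gt_at_top[of 0] by eventually_elim simp
  qed
  have w0: "(w \<longlongrightarrow> 0) at_top"
  proof (rule Lim_null_comparison)
    show "((\<lambda>t. 1 / c * (1 / t * (1 / t)) * (M + norm z0)) \<longlongrightarrow> 0) at_top"
      using tendsto_mult[OF tendsto_mult[OF tendsto_const[of "1 / c"] tendsto_mult[OF inv inv]] tendsto_const[of "M + norm z0"]]
      by (simp only: mult_zero_left mult_zero_right)
    show "eventually (\<lambda>t. norm (w t) \<le> 1 / c * (1 / t * (1 / t)) * (M + norm z0)) at_top"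
      using eventually_gt_at_top[of t0] M
    proof eventually_elim
      case (elim t)
      have "norm (w t) * (lam t * norm (w t)) \<le> norm (w t) * norm (x t - z0)"
        using order_trans[OF coc[OF elim(1) z0] norm_cauchy_schwarz] by (simp add: power2_eq_square algebra_simps)
      hence "lam t * norm (w t) \<le> norm (x t - z0) \<or> norm (w t) = 0"
        by (metis mult_le_cancel_left_pos zero_less_norm_iff norm_eq_zero)
      hence "lam t * norm (w t) \<le> norm (x t - z0)" by auto
      also have "\<dots> \<le> M + norm z0" using norm_triangle_ineq4[of "x t" z0] elim(2) by linarith
      finally show ?case using elim(1) t0 c by (simp add: lam power2_eq_square field_simps)
    qed
  qed
  have x''0: "((\<lambda>t. norm (x'' t)) \<longlongrightarrow> 0) at_top"
  proof (rule Lim_transform_eventually)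
    have "((\<lambda>t. (\<alpha> * (1 / t)) *\<^sub>R x' t) \<longlongrightarrow> (\<alpha> * 0) *\<^sub>R 0) at_top"
      by (intro tendsto_intros inv tendsto_norm_zero_cancel[OF x'0])
    hence "((\<lambda>t. norm (- w t - (\<alpha> * (1 / t)) *\<^sub>R x' t)) \<longlongrightarrow> norm (- 0 - 0 :: 'a)) at_top"
      by (intro tendsto_norm tendsto_diff tendsto_minus w0) simp
    thus "((\<lambda>t. norm (- w t - (\<alpha> * (1 / t)) *\<^sub>R x' t)) \<longlongrightarrow> 0) at_top" by simp
    show "eventually (\<lambda>t. norm (- w t - (\<alpha> * (1 / t)) *\<^sub>R x' t) = norm (x'' t)) at_top"
      using eventually_gt_at_top[of t0] by eventually_elim (simp add: w)
  qed
  \<comment> \<open>Split \<open>x t - a\<close> at the time \<open>s\<close> of small energy decay and at \<open>y = x s - \<lambda>(s) w s\<close>: the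
    errors \<open>x t - x s\<close> and \<open>x s - y\<close> are small, and \<open>(y - a) \<bullet> b \<le> (y - a) \<bullet> w s\<close> by monotonicity.\<close>
  have asym: "eventually (\<lambda>t. (x t - a) \<bullet> b \<le> e) at_top" if b: "b \<in> A a" and e: "e > 0" for a b e
  proof -
    define C where "C = c * (1 + \<alpha>)"
    \<comment> \<open>The total error when \<open>\<parallel>w\<parallel>\<close>, \<open>t \<parallel>x'\<parallel>\<close> and the bound \<open>D t\<close> are all at most \<open>r\<close>;
      \<open>C r\<close> bounds \<open>\<parallel>\<lambda>(s) w s\<parallel>\<close>.\<close>
    define \<eta> where "\<eta> r = r * norm b + C * r * norm b + (M + C * r + norm a) * r" for r
    have "(\<eta> \<longlongrightarrow> \<eta> 0) (at_right 0)" unfolding \<eta>_def by (intro tendsto_intros)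
    moreover have "\<eta> 0 < e" using e by (simp add: \<eta>_def)
    ultimately have "eventually (\<lambda>r. \<eta> r < e) (at_right 0)" by (rule order_tendstoD)
    moreover have "eventually (\<lambda>r::real. 0 < r) (at_right 0)" by (simp add: eventually_at_right_less)
    ultimately have "eventually (\<lambda>r. \<eta> r < e \<and> 0 < r) (at_right 0)" by eventually_elim simp
    then obtain r where r: "\<eta> r < e" "0 < r"
      using eventually_happens'[OF trivial_limit_at_right_real] by blast
    have "eventually (\<lambda>t. norm (x t) \<le> M \<and> norm (w t) < r \<and> t * norm (x' t) < r) at_top"
      using M order_tendstoD(2)[OF tendsto_norm_zero[OF w0] r(2)] order_tendstoD(2)[OF tx' r(2)]
      by eventually_elim simp
    then obtain T where T: "\<And>t. t \<ge> T \<Longrightarrow> norm (x t) \<le> M \<and> norm (w t) < r \<and> t * norm (x' t) < r"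
      unfolding eventually_at_top_linorder by blast
    show ?thesis
      using order_tendstoD(2)[OF D r(2)] eventually_gt_at_top[of t0] eventually_ge_at_top[of T]
    proof eventually_elim
      case (elim t)
      have tp: "t > 0" using elim t0 by simp
      obtain s where s: "s > t" "s < 2 * t" "s * norm (x' s) \<le> D t" "s\<^sup>2 * norm (x'' s) \<le> D t"
        using Ds elim by blast
      have st: "s > t0" "s \<ge> T" using s elim by auto
      have sp: "s > 0" using s tp by simp
      have x_close: "(x t - x s) \<bullet> b \<le> r * norm b"
      proof -
        have "((\<lambda>\<tau>. x \<tau> \<bullet> b) has_real_derivative (x' \<tau> \<bullet> b)) (at \<tau>)" if "t \<le> \<tau>" for \<tau>
          unfolding has_real_derivative_iff_has_vector_derivative
          using bounded_linear.has_vector_derivative[OF bounded_linear_inner_left dx] that elim by simp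
        then obtain \<xi> where \<xi>: "t < \<xi>" "\<xi> < s" "x s \<bullet> b - x t \<bullet> b = (s - t) * (x' \<xi> \<bullet> b)"
          using MVT2[OF s(1), of "\<lambda>\<tau>. x \<tau> \<bullet> b" "\<lambda>\<tau>. x' \<tau> \<bullet> b"] by blast
        have "(x t - x s) \<bullet> b = (s - t) * (- (x' \<xi> \<bullet> b))" using \<xi>(3) by (simp add: inner_diff_left algebra_simps)
        also have "\<dots> \<le> (s - t) * (norm (x' \<xi>) * norm b)"
          using s(1) norm_cauchy_schwarz[of "- x' \<xi>" b] by (intro mult_left_mono) auto
        also have "\<dots> \<le> \<xi> * (norm (x' \<xi>) * norm b)"
          using s(2) \<xi> by (intro mult_right_mono) auto
        also have "\<dots> = (\<xi> * norm (x' \<xi>)) * norm b" by simp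
        also have "\<dots> \<le> r * norm b"
          using T[of \<xi>] \<xi>(1) elim(3) by (intro mult_right_mono) auto
        finally show ?thesis .
      qed
      define u where "u = lam s *\<^sub>R w s"
      have u: "norm u \<le> C * r"
      proof -
        have "norm (w s) \<le> norm (x'' s) + \<alpha> / s * norm (x' s)"
          using norm_triangle_ineq[of "x'' s" "(\<alpha> / s) *\<^sub>R x' s"] \<alpha> sp
          unfolding w[OF st(1)] norm_minus_cancel by simp
        hence "norm u \<le> lam s * (norm (x'' s) + \<alpha> / s * norm (x' s))"
          using lam_pos[OF st(1)] by (simp add: u_def)
        also have "\<dots> = c * (s\<^sup>2 * norm (x'' s) + \<alpha> * (s * norm (x' s)))"
          using sp by (simp add: lam power2_eq_square field_simps)
        also have "\<dots> \<le> c * (r + \<alpha> * r)"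
          using s(3,4) elim(1) c \<alpha> by (intro mult_left_mono add_mono) auto
        finally show ?thesis by (simp add: C_def algebra_simps)
      qed
      define y where "y = x s - u"
      have ws: "w s \<in> A y"
        unfolding y_def u_def w_def using yosida_in_operator[OF A lam_pos[OF st(1)]] .
      have "0 \<le> (y - a) \<bullet> (w s - b)"
        using maximally_monotone_inner_nonneg[OF A ws b] .
      hence "(y - a) \<bullet> b \<le> (y - a) \<bullet> w s" by (simp add: inner_diff_right)
      also have "\<dots> \<le> norm (y - a) * norm (w s)" by (rule norm_cauchy_schwarz)
      also have "\<dots> \<le> (M + C * r + norm a) * r"
      proof (rule mult_mono)
        show "norm (y - a) \<le> M + C * r + norm a"
          using norm_triangle_ineq4[of "x s" u] norm_triangle_ineq4[of y a] T[OF st(2)] u unfolding y_def by linarith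
        thus "0 \<le> M + C * r + norm a" by (meson norm_ge_zero order_trans)
      qed (use T[OF st(2)] in auto)
      finally have ya: "(y - a) \<bullet> b \<le> (M + C * r + norm a) * r" .
      have "u \<bullet> b \<le> C * r * norm b"
        using order_trans[OF norm_cauchy_schwarz mult_right_mono[OF u]] by auto
      moreover have "(x t - a) \<bullet> b = (x t - x s) \<bullet> b + u \<bullet> b + (y - a) \<bullet> b"
        by (simp add: y_def inner_diff_left algebra_simps)
      ultimately have "(x t - a) \<bullet> b \<le> \<eta> r" using x_close ya unfolding \<eta>_def by linarith
      thus ?case using r by linarith
    qed
  qed
  have "\<exists>z\<in>S. weakly_tendsto x z at_top"
  proof (rule opial_halfspaces[where G = "{(a, b). b \<in> A a}"])
    show "S = {z. \<forall>(a, b)\<in>{(a, b). b \<in> A a}. (z - a) \<bullet> b \<le> 0}"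
      unfolding S_def zeros_eq_halfspaces[OF A] by auto
    show "S \<noteq> {}" using z0 by blast
    show "\<exists>l. ((\<lambda>t. (norm (x t - z))\<^sup>2) \<longlongrightarrow> l) at_top" if "z \<in> S" for z using est(1) that by blast
  qed (use asym in auto)
  thus ?thesis using x'0 x''0 unfolding S_def by blast
qed

end
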